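(* Let $\delta_1,\delta_2>0$ be constants and let $p=p(n)\in[0,1]$ be a sequence with $p = \omega(n^{-1/2+\delta_1})$ and $p = o(n^{-3/7-\delta_2})$ as $n\to\infty$. Then the random graph $G(n,p)$ is locally asymmetric asymptotically almost surely, i.e. $\mathbb{P}[G(n,p)\text{ is locally asymmetric}]\to 1$ as $n\to\infty$.
   Context: Graphs are finite, simple and undirected. $G(n,p)$ is the Erdős–Rényi random graph on $n$ labeled vertices in which each of the $\binom n2$ possible edges is present independently with probability $p$. For a vertex $v$ of a graph $G$, let $\mathcal{N}(v)$ be the set consisting of $v$ and all its neighbors, and let $\mathcal{N}[v] = G[\mathcal{N}(v)]$ be the subgraph of $G$ induced by this set. Two vertices $v_1,v_2$ of $G$ are locally symmetric (i.e. $1$-locally symmetric) if there is a graph isomorphism $f$ from $\mathcal{N}[v_1]$ to $\mathcal{N}[v_2]$ with $f(v_1)=v_2$. The graph $G$ is locally symmetric if it has two distinct vertices that are locally symmetric, and locally asymmetric if it is not locally symmetric. Here $p=\omega(g(n))$ means $p/g(n)\to\infty$ and $p=o(g(n))$ means $p/g(n)\to 0$. *)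

theory Defs
  imports
    "HOL-Probability.Probability"
    "HOL-Library.Landau_Symbols"
    "HOL-Library.Ramsey"
begin

(* A graph is a pair (V, E) of a vertex set and a set of 2-element vertex subsets. *)
type_synonym 'a graph = "'a set \<times> 'a set set"

abbreviation verts :: "'a graph \<Rightarrow> 'a set" where
  "verts \<equiv> fst"

abbreviation edges :: "'a graph \<Rightarrow> 'a set set" where
  "edges \<equiv> snd"

definition simple_graph :: "'a graph \<Rightarrow> bool" where
  "simple_graph G \<longleftrightarrow> finite (verts G) \<and> edges G \<subseteq> nsets (verts G) 2"

definition induced_subgraph :: "'a graph \<Rightarrow> 'a set \<Rightarrow> 'a graph" where
  "induced_subgraph G S = (S, {e \<in> edges G. e \<subseteq> S})"

definition closed_nbhd :: "'a graph \<Rightarrow> 'a \<Rightarrow> 'a set" where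
  "closed_nbhd G v = insert v {u \<in> verts G. {v, u} \<in> edges G}"

definition nbhd_graph :: "'a graph \<Rightarrow> 'a \<Rightarrow> 'a graph" where
  "nbhd_graph G v = induced_subgraph G (closed_nbhd G v)"

(* In the case u = w both edge conditions are false for simple graphs. *)
definition graph_isomorphism :: "('a \<Rightarrow> 'b) \<Rightarrow> 'a graph \<Rightarrow> 'b graph \<Rightarrow> bool" where
  "graph_isomorphism f G H \<longleftrightarrow>
     bij_betw f (verts G) (verts H) \<and>
     (\<forall>u\<in>verts G. \<forall>w\<in>verts G. {u, w} \<in> edges G \<longleftrightarrow> {f u, f w} \<in> edges H)"

definition locally_symmetric_verts :: "'a graph \<Rightarrow> 'a \<Rightarrow> 'a \<Rightarrow> bool" where
  "locally_symmetric_verts G v1 v2 \<longleftrightarrow>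
     (\<exists>f. graph_isomorphism f (nbhd_graph G v1) (nbhd_graph G v2) \<and> f v1 = v2)"

definition locally_symmetric :: "'a graph \<Rightarrow> bool" where
  "locally_symmetric G \<longleftrightarrow>
     (\<exists>v1\<in>verts G. \<exists>v2\<in>verts G. v1 \<noteq> v2 \<and> locally_symmetric_verts G v1 v2)"

definition locally_asymmetric :: "'a graph \<Rightarrow> bool" where
  "locally_asymmetric G \<longleftrightarrow> \<not> locally_symmetric G"

(* The vertices are 0, ..., n - 1; X e says whether the possible edge e is present.
   The edge indicators X e are independent, and X is False outside the possible edges.
   bernoulli_pmf p has success probability p only for p in [0, 1]. *)
definition erdos_renyi :: "nat \<Rightarrow> real \<Rightarrow> nat graph pmf" where
  "erdos_renyi n p =
     map_pmf (\<lambda>X. ({..<n}, {e. X e}))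
       (Pi_pmf (nsets {..<n} 2) False (\<lambda>_. bernoulli_pmf p))"

lemma simple_graph_erdos_renyi:
  assumes "G \<in> set_pmf (erdos_renyi n p)"
  shows "simple_graph G" and "verts G = {..<n}"
proof -
  have fin: "finite (nsets {..<n} 2)"
    by (simp add: finite_imp_finite_nsets)
  obtain X where G: "G = ({..<n}, {e. X e})"
    and X: "X \<in> set_pmf (Pi_pmf (nsets {..<n} 2) False (\<lambda>_. bernoulli_pmf p))"
    using assms by (auto simp: erdos_renyi_def)
  have "X \<in> PiE_dflt (nsets {..<n} 2) False (set_pmf \<circ> (\<lambda>_. bernoulli_pmf p))"
    by (rule subsetD[OF set_Pi_pmf_subset'[OF fin] X])
  then have "\<And>e. X e \<Longrightarrow> e \<in> nsets {..<n} 2"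
    by (auto simp: PiE_dflt_def)
  then show "simple_graph G" "verts G = {..<n}"
    using G by (auto simp: simple_graph_def)
qed

end

theory Submission
  imports Defs
begin

text \<open>
  Let \<open>d = np\<close>. A neighbourhood is essentially a random graph on about \<open>d\<close> vertices, and the
  hypothesis \<open>p = \<omega>(n powr (- 1 / 2 + \<delta>1))\<close> makes its average degree \<open>dp = np\<^sup>2\<close>
  at least a positive power of \<open>n\<close>, far above \<open>ln n\<close>. Two independent graphs of this kind are isomorphic with probability at most about
  \<open>d! exp (- p d\<^sup>2)\<close>, which is tiny because \<open>p d\<close> dominates \<open>ln d\<close>. The obstacle is that two
  neighbourhoods in the same graph are neither independent nor disjoint.

  The obstacle disappears after passing to a subset. An isomorphism between the neighbourhoods
  of \<open>v1\<close> and \<open>v2\<close> maps every subset \<open>S\<close> of \<open>N(v1) - N(v2)\<close> into \<open>N(v2)\<close>, so \<open>S\<close> and its image are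
  vertex-disjoint and induce isomorphic subgraphs
  (\<open>disjoint_isomorphic_copies_if_locally_symmetric_verts\<close>). It therefore suffices that, for a
  suitable \<open>m\<close> of order \<open>np\<close>, two things hold with high probability.

  First, the difference \<open>N(v1) - N(v2)\<close> has at least \<open>m\<close> elements for all pairs at once. Its size
  dominates a sum of independent indicators with mean about \<open>np\<close>, and Hoeffding's inequality bounds
  the failure probability of one pair by \<open>exp (- c n p\<^sup>2)\<close>, which beats the \<open>n\<^sup>2\<close> pairs
  (\<open>prob_small_nbhd_difference_le\<close>).

  Second, no two disjoint \<open>m\<close>-sets induce isomorphic subgraphs. There are at most \<open>n ^ (2 * m)\<close> pairs of
  enumerated \<open>m\<close>-sets. For each disjoint one the \<open>m choose 2\<close> pairs of corresponding potential edges
  agree independently, each with probability \<open>1 - 2p(1 - p)\<close>, so the expected number of matching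
  pairs is at most \<open>exp (m (2 ln n - p(1 - p)(m - 1)))\<close>
  (\<open>prob_disjoint_isomorphic_copies_le\<close>).

  Together they give the explicit bound \<open>2 / n\<close> whenever \<open>np\<^sup>2 \<ge> 96 ln n\<close>, \<open>0 \<le> p \<le> 1 / 2\<close> and \<open>n \<ge> 4\<close>
  (\<open>prob_locally_symmetric_le\<close>), and the hypotheses on the growth of \<open>p\<close> imply these conditions for
  large \<open>n\<close>.
\<close>

section \<open>Functions of disjoint pairs of independent Bernoulli variables\<close>

text \<open>
  The two random quantities of the proof have the same form. They count or test an event about the
  two coordinates \<open>\<alpha> i\<close> and \<open>\<beta> i\<close>, where all these coordinates are distinct. For neighbourhood
  differences they are the edges from one vertex to \<open>v1\<close> and to \<open>v2\<close>; for isomorphic copies they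
  are a potential edge and its image. Each event reads its own block of two coordinates, and
  disjoint blocks of independent variables are independent.
\<close>

lemma indep_vars_disjoint_pairs:
  fixes h :: "bool \<Rightarrow> bool \<Rightarrow> bool"
  assumes A: "finite A" and \<alpha>: "\<alpha> ` I \<subseteq> A" "inj_on \<alpha> I" and \<beta>: "\<beta> ` I \<subseteq> A" "inj_on \<beta> I"
    and disj: "\<alpha> ` I \<inter> \<beta> ` I = {}"
  shows "prob_space.indep_vars (measure_pmf (Pi_pmf A d P)) (\<lambda>_. count_space UNIV)
           (\<lambda>i X. h (X (\<alpha> i)) (X (\<beta> i))) I"
proof -
  let ?K = "\<lambda>i. {\<alpha> i, \<beta> i}"
  let ?Y = "\<lambda>i (x::'a \<Rightarrow> bool). h (x (\<alpha> i)) (x (\<beta> i))"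
  have "?K i \<inter> ?K j = {}" if "i \<in> I" "j \<in> I" "i \<noteq> j" for i j
  proof -
    have "\<alpha> i \<noteq> \<alpha> j" "\<beta> i \<noteq> \<beta> j"
      using that \<alpha> \<beta> by (simp_all add: inj_on_eq_iff)
    moreover have "\<alpha> i \<noteq> \<beta> j" "\<beta> i \<noteq> \<alpha> j"
      using that disj by (metis disjoint_iff imageI)+
    ultimately show ?thesis
      by simp
  qed
  then have "disjoint_family_on ?K I"
    by (simp add: disjoint_family_on_def)
  then have "prob_space.indep_vars (measure_pmf (Pi_pmf A d P)) (\<lambda>j. PiM (?K j) (\<lambda>_. count_space UNIV))
      (\<lambda>j X. restrict (\<lambda>i. X i) (?K j)) I"
    using \<alpha> \<beta> by (intro prob_space.indep_vars_restrict[OF measure_pmf.prob_space_axioms indep_vars_Pi_pmf[OF A]]) auto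
  then have "prob_space.indep_vars (measure_pmf (Pi_pmf A d P)) (\<lambda>_. count_space UNIV) (\<lambda>j X. ?Y j (restrict (\<lambda>i. X i) (?K j))) I"
  proof (rule prob_space.indep_vars_compose2[OF measure_pmf.prob_space_axioms])
    fix i
    have [measurable]:
      "Measurable.pred (PiM (?K i) (\<lambda>_. count_space UNIV)) (\<lambda>x. x (\<alpha> i))"
      "Measurable.pred (PiM (?K i) (\<lambda>_. count_space UNIV)) (\<lambda>x. x (\<beta> i))"
      by (auto intro!: measurable_component_singleton)
    \<comment> \<open>Writing \<open>h\<close> as its truth table leaves only Boolean combinations of coordinates.\<close>
    have "?Y i = (\<lambda>x. (x (\<alpha> i) \<and> x (\<beta> i) \<and> h True True) \<or> (x (\<alpha> i) \<and> \<not> x (\<beta> i) \<and> h True False) \<or>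
        (\<not> x (\<alpha> i) \<and> x (\<beta> i) \<and> h False True) \<or> (\<not> x (\<alpha> i) \<and> \<not> x (\<beta> i) \<and> h False False))"
    proof
      fix x :: "'a \<Rightarrow> bool"
      show "?Y i x = ((x (\<alpha> i) \<and> x (\<beta> i) \<and> h True True) \<or> (x (\<alpha> i) \<and> \<not> x (\<beta> i) \<and> h True False) \<or>
        (\<not> x (\<alpha> i) \<and> x (\<beta> i) \<and> h False True) \<or> (\<not> x (\<alpha> i) \<and> \<not> x (\<beta> i) \<and> h False False))"
        by (cases "x (\<alpha> i)"; cases "x (\<beta> i)") simp_all
    qed
    moreover have "Measurable.pred (PiM (?K i) (\<lambda>_. count_space UNIV)) \<dots>"
      by measurable
    ultimately show "?Y i \<in> PiM (?K i) (\<lambda>_. count_space UNIV) \<rightarrow>\<^sub>M count_space UNIV"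
      by (simp only:)
  qed
  then show ?thesis
    by simp
qed

lemma prob_two_coordinates:
  assumes A: "finite A" "a \<in> A" "b \<in> A" "a \<noteq> b"
  shows "measure_pmf.prob (Pi_pmf A d P) {X. X a \<in> S \<and> X b \<in> T} =
           measure_pmf.prob (P a) S * measure_pmf.prob (P b) T"
proof -
  have "{X. X a \<in> S \<and> X b \<in> T} = Pi A (\<lambda>x. if x = a then S else if x = b then T else UNIV)"
    using A by (auto simp: Pi_def split: if_splits)
  then have "measure_pmf.prob (Pi_pmf A d P) {X. X a \<in> S \<and> X b \<in> T} =
      (\<Prod>x\<in>A. measure_pmf.prob (P x) (if x = a then S else if x = b then T else UNIV))"
    by (simp add: measure_Pi_pmf_Pi A)
  also have "\<dots> = (\<Prod>x\<in>{a, b}. measure_pmf.prob (P x) (if x = a then S else if x = b then T else UNIV))"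
    using A by (intro prod.mono_neutral_right) auto
  finally show ?thesis
    using A by simp
qed

lemma prob_bernoulli_singleton:
  assumes "p \<in> {0..1}"
  shows "measure_pmf.prob (bernoulli_pmf p) {True} = p"
    "measure_pmf.prob (bernoulli_pmf p) {False} = 1 - p"
  using assms by (simp_all add: measure_pmf_single)

lemma prob_all_pairs_agree:
  assumes A: "finite A" and \<alpha>: "\<alpha> ` I \<subseteq> A" "inj_on \<alpha> I" and \<beta>: "\<beta> ` I \<subseteq> A" "inj_on \<beta> I"
    and disj: "\<alpha> ` I \<inter> \<beta> ` I = {}" and p: "p \<in> {0..1}"
  shows "measure_pmf.prob (Pi_pmf A False (\<lambda>_. bernoulli_pmf p)) {X. \<forall>i\<in>I. X (\<alpha> i) = X (\<beta> i)} =
           (1 - 2 * (p * (1 - p))) ^ card I"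
proof (cases "I = {}")
  case False
  let ?M = "Pi_pmf A False (\<lambda>_. bernoulli_pmf p)"
  have "finite I"
    using A \<alpha> finite_subset finite_imageD by blast
  have pair: "measure_pmf.prob ?M {X. X (\<alpha> i) = X (\<beta> i)} = 1 - 2 * (p * (1 - p))" if "i \<in> I" for i
  proof -
    have ab: "\<alpha> i \<in> A" "\<beta> i \<in> A" "\<alpha> i \<noteq> \<beta> i"
      using that \<alpha> \<beta> disj by auto
    have "{X. X (\<alpha> i) = X (\<beta> i)} = {X. X (\<alpha> i) \<in> {True} \<and> X (\<beta> i) \<in> {True}} \<union>
        {X. X (\<alpha> i) \<in> {False} \<and> X (\<beta> i) \<in> {False}}"
      by auto
    then have "measure_pmf.prob ?M {X. X (\<alpha> i) = X (\<beta> i)} =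
        measure_pmf.prob ?M {X. X (\<alpha> i) \<in> {True} \<and> X (\<beta> i) \<in> {True}} +
        measure_pmf.prob ?M {X. X (\<alpha> i) \<in> {False} \<and> X (\<beta> i) \<in> {False}}"
      by (simp only:) (rule measure_pmf.finite_measure_Union, auto)
    also have "\<dots> = p * p + (1 - p) * (1 - p)"
      using p by (simp only: prob_two_coordinates[OF A ab] prob_bernoulli_singleton)
    finally show ?thesis
      by (simp add: algebra_simps)
  qed
  have "measure_pmf.prob ?M (\<Inter>i\<in>I. (\<lambda>X. X (\<alpha> i) = X (\<beta> i)) -` {True} \<inter> space (measure_pmf ?M)) =
      (\<Prod>i\<in>I. measure_pmf.prob ?M ((\<lambda>X. X (\<alpha> i) = X (\<beta> i)) -` {True} \<inter> space (measure_pmf ?M)))"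
    using indep_vars_disjoint_pairs[OF A \<alpha> \<beta> disj, of False "\<lambda>_. bernoulli_pmf p" "(=)"] False \<open>finite I\<close>
    by (intro prob_space.indep_varsD_finite[OF measure_pmf.prob_space_axioms]) auto
  also have "\<dots> = (\<Prod>i\<in>I. measure_pmf.prob ?M {X. X (\<alpha> i) = X (\<beta> i)})"
    by (simp add: vimage_def)
  finally have "measure_pmf.prob ?M (\<Inter>i\<in>I. {X. X (\<alpha> i) = X (\<beta> i)}) = (1 - 2 * (p * (1 - p))) ^ card I"
    by (simp add: vimage_def pair)
  moreover have "measure_pmf.prob ?M {X. \<forall>i\<in>I. X (\<alpha> i) = X (\<beta> i)} =
      measure_pmf.prob ?M (\<Inter>i\<in>I. {X. X (\<alpha> i) = X (\<beta> i)})"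
    by (intro arg_cong[where f = "measure_pmf.prob ?M"] set_eqI) simp
  ultimately show ?thesis
    by (simp only:)
qed simp

text \<open>
  The indicators of the events \<open>X (\<alpha> i) \<and> \<not> X (\<beta> i)\<close> are independent with mean \<open>p (1 - p)\<close>, so this is
  Hoeffding's inequality for their sum.
\<close>

lemma prob_few_pairs_le:
  assumes A: "finite A" and \<alpha>: "\<alpha> ` I \<subseteq> A" "inj_on \<alpha> I" and \<beta>: "\<beta> ` I \<subseteq> A" "inj_on \<beta> I"
    and disj: "\<alpha> ` I \<inter> \<beta> ` I = {}" and p: "p \<in> {0..1}" and I: "I \<noteq> {}" and \<epsilon>: "\<epsilon> \<ge> 0"
  shows "measure_pmf.prob (Pi_pmf A False (\<lambda>_. bernoulli_pmf p))
           {X. real (card {i\<in>I. X (\<alpha> i) \<and> \<not> X (\<beta> i)}) \<le> real (card I) * (p * (1 - p)) - \<epsilon>}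
         \<le> exp (- 2 * \<epsilon>\<^sup>2 / real (card I))"
proof -
  let ?M = "Pi_pmf A False (\<lambda>_. bernoulli_pmf p)"
  let ?Z = "\<lambda>i X. of_bool (X (\<alpha> i) \<and> \<not> X (\<beta> i)) :: real"
  have "finite I"
    using A \<alpha> finite_subset finite_imageD by blast
  have mean: "measure_pmf.expectation ?M (?Z i) = p * (1 - p)" if "i \<in> I" for i
  proof -
    have ab: "\<alpha> i \<in> A" "\<beta> i \<in> A" "\<alpha> i \<noteq> \<beta> i"
      using that \<alpha> \<beta> disj by auto
    have "?Z i = indicator {X. X (\<alpha> i) \<in> {True} \<and> X (\<beta> i) \<in> {False}}"
      by (auto simp: indicator_def)
    then have "measure_pmf.expectation ?M (?Z i) =
        measure_pmf.prob ?M {X. X (\<alpha> i) \<in> {True} \<and> X (\<beta> i) \<in> {False}}"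
      by simp
    then show ?thesis
      using p by (simp only: prob_two_coordinates[OF A ab] prob_bernoulli_singleton)
  qed
  interpret Hoeffding_ineq "measure_pmf ?M" I ?Z "\<lambda>_. 0" "\<lambda>_. 1" "real (card I) * (p * (1 - p))"
  proof unfold_locales
    show "prob_space.indep_vars (measure_pmf ?M) (\<lambda>_. borel) ?Z I"
      by (rule prob_space.indep_vars_compose2[OF measure_pmf.prob_space_axioms
            indep_vars_disjoint_pairs[OF A \<alpha> \<beta> disj, where h = "\<lambda>x y. x \<and> \<not> y"]]) simp
  qed (simp_all add: \<open>finite I\<close> mean)
  have "(\<Sum>i\<in>I. ?Z i X) = real (card {i\<in>I. X (\<alpha> i) \<and> \<not> X (\<beta> i)})" for X
    using \<open>finite I\<close> by (simp add: of_bool_def sum.If_cases Int_def)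
  then show ?thesis
    using Hoeffding_ineq_le[OF \<epsilon>] I \<open>finite I\<close> by (simp add: card_gt_0_iff)
qed

section \<open>Disjoint isomorphic copies inside a random graph\<close>

text \<open>
  The two vertex sets come with enumerations \<open>a\<close> and \<open>b\<close> that carry the isomorphism: it sends \<open>a i\<close>
  to \<open>b i\<close>. A pair of enumerations determines both sets and the isomorphism, so the union bound
  below ranges over only \<open>n ^ (2 * m)\<close> cases.
\<close>

definition disjoint_isomorphic_copies :: "'a graph \<Rightarrow> nat \<Rightarrow> bool" where
  "disjoint_isomorphic_copies G m \<longleftrightarrow>
     (\<exists>a\<in>{..<m} \<rightarrow>\<^sub>E verts G. \<exists>b\<in>{..<m} \<rightarrow>\<^sub>E verts G.
        inj_on a {..<m} \<and> inj_on b {..<m} \<and> a ` {..<m} \<inter> b ` {..<m} = {} \<and>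
        (\<forall>e\<in>nsets {..<m} 2. a ` e \<in> edges G \<longleftrightarrow> b ` e \<in> edges G))"

text \<open>
  Choose \<open>m\<close> vertices in the difference of the neighbourhoods. The local isomorphism maps them into
  the neighbourhood of \<open>v2\<close>, which contains none of them. This disjointness makes the events about
  corresponding edges independent later on.
\<close>

lemma disjoint_isomorphic_copies_if_locally_symmetric_verts:
  assumes v: "v1 \<in> verts G" "v2 \<in> verts G"
    and sym: "locally_symmetric_verts G v1 v2"
    and m: "m \<le> card (closed_nbhd G v1 - closed_nbhd G v2)"
  shows "disjoint_isomorphic_copies G m"
proof -
  let ?N = "closed_nbhd G"
  have N: "?N v1 \<subseteq> verts G" "?N v2 \<subseteq> verts G"
    using v by (auto simp: closed_nbhd_def)
  obtain f where iso: "graph_isomorphism f (nbhd_graph G v1) (nbhd_graph G v2)"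
    using sym by (auto simp: locally_symmetric_verts_def)
  have f: "bij_betw f (?N v1) (?N v2)"
    and fe: "\<forall>u\<in>?N v1. \<forall>w\<in>?N v1.
      ({u, w} \<in> edges G \<and> {u, w} \<subseteq> ?N v1) = ({f u, f w} \<in> edges G \<and> {f u, f w} \<subseteq> ?N v2)"
    using iso unfolding graph_isomorphism_def nbhd_graph_def induced_subgraph_def
      fst_conv snd_conv mem_Collect_eq
    by simp_all
  obtain S where S: "S \<subseteq> ?N v1 - ?N v2" "card S = m" "finite S"
    using obtain_subset_with_card_n[OF m] by metis
  obtain a where a: "bij_betw a {..<m} S"
    using ex_bij_betw_nat_finite[OF \<open>finite S\<close>] S by (auto simp: atLeast0LessThan)
  let ?a = "restrict a {..<m}" and ?b = "restrict (f \<circ> a) {..<m}"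
  have aS: "a i \<in> S" if "i < m" for i
    using a that by (auto simp: bij_betw_def)
  have fS: "f u \<in> ?N v2" if "u \<in> ?N v1" for u
    using f that by (auto simp: bij_betw_def)
  have "?a \<in> {..<m} \<rightarrow>\<^sub>E verts G" "?b \<in> {..<m} \<rightarrow>\<^sub>E verts G"
  proof -
    have "a i \<in> verts G" "f (a i) \<in> verts G" if "i < m" for i
      using aS[OF that] fS[of "a i"] S N by blast+
    then show "?a \<in> {..<m} \<rightarrow>\<^sub>E verts G" "?b \<in> {..<m} \<rightarrow>\<^sub>E verts G"
      by (simp_all add: restrict_PiE_iff)
  qed
  moreover have "inj_on ?a {..<m}" "inj_on ?b {..<m}"
  proof -
    show "inj_on ?a {..<m}"
      using a by (auto simp: bij_betw_def inj_on_def)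
    have "inj_on f S"
      using f S by (auto simp: bij_betw_def intro: inj_on_subset)
    then have "inj_on (f \<circ> a) {..<m}"
      using a by (intro comp_inj_on) (auto simp: bij_betw_def)
    then show "inj_on ?b {..<m}"
      by (auto simp: inj_on_def)
  qed
  moreover have "?a ` {..<m} \<inter> ?b ` {..<m} = {}"
  proof -
    have "?a ` {..<m} \<subseteq> S" "?b ` {..<m} \<subseteq> ?N v2"
      using aS fS S by auto
    then show ?thesis
      using S by blast
  qed
  moreover have "?a ` e \<in> edges G \<longleftrightarrow> ?b ` e \<in> edges G" if e: "e \<in> nsets {..<m} 2" for e
  proof -
    obtain i j where ij: "e = {i, j}" "i < m" "j < m"
      using e by (auto simp: nsets_2_eq)
    then have "a i \<in> ?N v1" "a j \<in> ?N v1"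
      using aS S by auto
    then show ?thesis
      using fe[rule_format, of "a i" "a j"] fS ij by simp
  qed
  ultimately show ?thesis
    unfolding disjoint_isomorphic_copies_def by blast
qed

lemma prob_erdos_renyi:
  "measure_pmf.prob (erdos_renyi n p) S =
   measure_pmf.prob (Pi_pmf (nsets {..<n} 2) False (\<lambda>_. bernoulli_pmf p)) {X. ({..<n}, {e. X e}) \<in> S}"
  by (simp add: erdos_renyi_def vimage_def)

text \<open>
  Fix two injective enumerations with disjoint ranges. The potential edges inside the first range
  and those inside the second are all different, so the \<open>m choose 2\<close> coincidences are independent.
  The bound sums over all pairs of enumerations.
\<close>

lemma prob_disjoint_isomorphic_copies_le:
  assumes p: "p \<in> {0..1}"
  shows "measure_pmf.prob (erdos_renyi n p) {G. disjoint_isomorphic_copies G m}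
         \<le> real n ^ (2 * m) * (1 - 2 * (p * (1 - p))) ^ (m choose 2)"
proof -
  let ?M = "Pi_pmf (nsets {..<n} 2) False (\<lambda>_. bernoulli_pmf p)"
  let ?F = "{..<m} \<rightarrow>\<^sub>E {..<n}" and ?I = "nsets {..<m} 2"
  let ?q = "(1 - 2 * (p * (1 - p))) ^ (m choose 2)"
  let ?ok = "\<lambda>(a, b). inj_on a {..<m} \<and> inj_on b {..<m} \<and> a ` {..<m} \<inter> b ` {..<m} = {}"
  let ?P = "{ab \<in> ?F \<times> ?F. ?ok ab}"
  let ?ev = "\<lambda>(a, b). {X. \<forall>e\<in>?I. X (a ` e) = X (b ` e)}"
  have fin: "finite (nsets {..<n} 2)" "finite ?F"
    by (auto simp: finite_imp_finite_nsets intro: finite_PiE)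
  have q: "0 \<le> ?q"
  proof -
    have "1 - 2 * (p * (1 - p)) = p\<^sup>2 + (1 - p)\<^sup>2"
      by (simp add: power2_eq_square algebra_simps)
    then show ?thesis by simp
  qed
  have single: "measure_pmf.prob ?M (?ev ab) = ?q" if "ab \<in> ?P" for ab
  proof -
    obtain a b where ab: "ab = (a, b)" by force
    have inj: "inj_on a {..<m}" "inj_on b {..<m}" and disj: "a ` {..<m} \<inter> b ` {..<m} = {}"
      and F: "a \<in> ?F" "b \<in> ?F"
      using that ab by auto
    have img: "image c ` ?I \<subseteq> nsets {..<n} 2" if "c \<in> ?F" "inj_on c {..<m}" for c
      using that by (intro image_subsetI) (auto simp: nsets_def card_image inj_on_subset)
    have "a ` e \<noteq> b ` e'" if "e \<in> ?I" "e' \<in> ?I" for e e'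
    proof -
      have "e \<noteq> {}" "e \<subseteq> {..<m}" "e' \<subseteq> {..<m}"
        using that by (auto simp: nsets_def)
      then show ?thesis
        using disj by blast
    qed
    then have "image a ` ?I \<inter> image b ` ?I = {}"
      by auto
    then have "measure_pmf.prob ?M {X. \<forall>e\<in>?I. X (a ` e) = X (b ` e)} =
        (1 - 2 * (p * (1 - p))) ^ card ?I"
      using inj F by (intro prob_all_pairs_agree fin p img inj_on_nsets)
    then show ?thesis
      by (simp add: ab card_nsets)
  qed
  have "{X. disjoint_isomorphic_copies ({..<n}, {e. X e}) m} \<subseteq> (\<Union>ab\<in>?P. ?ev ab)"
    by (auto simp: disjoint_isomorphic_copies_def)
  then have "measure_pmf.prob ?M {X. disjoint_isomorphic_copies ({..<n}, {e. X e}) m} \<le>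
      measure_pmf.prob ?M (\<Union>ab\<in>?P. ?ev ab)"
    by (intro measure_pmf.finite_measure_mono) auto
  also have "\<dots> \<le> (\<Sum>ab\<in>?P. measure_pmf.prob ?M (?ev ab))"
    using fin by (intro measure_pmf.finite_measure_subadditive_finite) auto
  also have "\<dots> = real (card ?P) * ?q"
    using single by simp
  also have "\<dots> \<le> real (card (?F \<times> ?F)) * ?q"
    using fin q by (intro mult_right_mono of_nat_mono card_mono) auto
  also have "card (?F \<times> ?F) = n ^ (2 * m)"
    by (simp add: card_cartesian_product card_PiE power_add mult_2)
  finally show ?thesis
    by (simp add: prob_erdos_renyi)
qed

section \<open>Neighbourhoods have large differences\<close>

text \<open>
  A vertex other than \<open>v1\<close> and \<open>v2\<close> lies in the difference if it is adjacent to \<open>v1\<close> and not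
  to \<open>v2\<close>. These events concern different potential edges for different vertices.
\<close>

lemma prob_small_nbhd_difference_le:
  assumes p: "p \<in> {0..1}" and v: "v1 < n" "v2 < n" "v1 \<noteq> v2" and n: "n > 2" and \<epsilon>: "\<epsilon> \<ge> 0"
    and m: "real m \<le> real (n - 2) * (p * (1 - p)) - \<epsilon>"
  shows "measure_pmf.prob (erdos_renyi n p) {G. card (closed_nbhd G v1 - closed_nbhd G v2) < m}
         \<le> exp (- 2 * \<epsilon>\<^sup>2 / real (n - 2))"
proof -
  let ?M = "Pi_pmf (nsets {..<n} 2) False (\<lambda>_. bernoulli_pmf p)"
  let ?I = "{..<n} - {v1, v2}"
  have cardI: "card ?I = n - 2"
    using v by (simp add: card_Diff_subset)
  have count: "card {u\<in>?I. X {v1, u} \<and> \<not> X {v2, u}} \<le>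
      card (closed_nbhd ({..<n}, {e. X e}) v1 - closed_nbhd ({..<n}, {e. X e}) v2)" for X
    by (rule card_mono) (auto simp: closed_nbhd_def)
  have "measure_pmf.prob (erdos_renyi n p) {G. card (closed_nbhd G v1 - closed_nbhd G v2) < m} \<le>
      measure_pmf.prob ?M {X. real (card {u\<in>?I. X {v1, u} \<and> \<not> X {v2, u}}) \<le>
        real (card ?I) * (p * (1 - p)) - \<epsilon>}"
    unfolding prob_erdos_renyi
  proof (rule measure_pmf.finite_measure_mono, rule subsetI)
    fix X assume "X \<in> {X. ({..<n}, {e. X e}) \<in> {G. card (closed_nbhd G v1 - closed_nbhd G v2) < m}}"
    then have "card {u\<in>?I. X {v1, u} \<and> \<not> X {v2, u}} < m"
      using count[of X] by simp
    then show "X \<in> {X. real (card {u\<in>?I. X {v1, u} \<and> \<not> X {v2, u}}) \<le>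
        real (card ?I) * (p * (1 - p)) - \<epsilon>}"
      using m by (simp add: cardI)
  qed simp
  also have "\<dots> \<le> exp (- 2 * \<epsilon>\<^sup>2 / real (card ?I))"
  proof (rule prob_few_pairs_le)
    show "finite (nsets {..<n} 2)"
      by (simp add: finite_imp_finite_nsets)
    show "(\<lambda>u. {v1, u}) ` ?I \<inter> (\<lambda>u. {v2, u}) ` ?I = {}"
      using v by (auto simp: doubleton_eq_iff)
    show "?I \<noteq> {}"
      using cardI n by (metis card.empty less_numeral_extra(3) zero_less_diff)
  qed (use v p \<epsilon> in \<open>auto simp: inj_on_def doubleton_eq_iff\<close>)
  finally show ?thesis
    by (simp only: cardI)
qed

section \<open>The probability of local symmetry\<close>

lemma prob_locally_symmetric_le_sum:
  assumes p: "p \<in> {0..1}" and n: "n > 2" and \<epsilon>: "\<epsilon> \<ge> 0"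
    and m: "real m \<le> real (n - 2) * (p * (1 - p)) - \<epsilon>"
  shows "measure_pmf.prob (erdos_renyi n p) {G. locally_symmetric G}
         \<le> (real n)\<^sup>2 * exp (- 2 * \<epsilon>\<^sup>2 / real (n - 2)) +
            real n ^ (2 * m) * (1 - 2 * (p * (1 - p))) ^ (m choose 2)"
proof -
  let ?M = "erdos_renyi n p"
  let ?P = "{v \<in> {..<n} \<times> {..<n}. fst v \<noteq> snd v}"
  let ?small = "\<lambda>v. {G. card (closed_nbhd G (fst v) - closed_nbhd G (snd v)) < m}"
  have "measure_pmf.prob ?M {G. locally_symmetric G} \<le>
      measure_pmf.prob ?M ((\<Union>v\<in>?P. ?small v) \<union> {G. disjoint_isomorphic_copies G m})"
  proof (rule measure_pmf.finite_measure_mono_AE)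
    show "AE G in measure_pmf ?M. G \<in> {G. locally_symmetric G} \<longrightarrow>
        G \<in> (\<Union>v\<in>?P. ?small v) \<union> {G. disjoint_isomorphic_copies G m}"
    proof (rule AE_pmfI, rule impI)
      fix G assume G: "G \<in> set_pmf ?M" and "G \<in> {G. locally_symmetric G}"
      then obtain v1 v2 where v: "v1 < n" "v2 < n" "v1 \<noteq> v2" "locally_symmetric_verts G v1 v2"
        using simple_graph_erdos_renyi(2)[OF G] by (auto simp: locally_symmetric_def)
      show "G \<in> (\<Union>v\<in>?P. ?small v) \<union> {G. disjoint_isomorphic_copies G m}"
      proof (cases "card (closed_nbhd G v1 - closed_nbhd G v2) < m")
        case True
        then show ?thesis
          using v by (intro UnI1 UN_I[of "(v1, v2)"]) simp_all
      next
        case False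
        then have "disjoint_isomorphic_copies G m"
          using v simple_graph_erdos_renyi(2)[OF G]
          by (intro disjoint_isomorphic_copies_if_locally_symmetric_verts[of v1 G v2]) auto
        then show ?thesis
          by simp
      qed
    qed
  qed simp
  also have "\<dots> \<le> measure_pmf.prob ?M (\<Union>v\<in>?P. ?small v) +
      measure_pmf.prob ?M {G. disjoint_isomorphic_copies G m}"
    by (intro measure_Un_le) auto
  also have "measure_pmf.prob ?M (\<Union>v\<in>?P. ?small v) \<le> (\<Sum>v\<in>?P. measure_pmf.prob ?M (?small v))"
    by (intro measure_pmf.finite_measure_subadditive_finite) auto
  also have "\<dots> \<le> (\<Sum>v\<in>?P. exp (- 2 * \<epsilon>\<^sup>2 / real (n - 2)))"
    using p n \<epsilon> m by (intro sum_mono prob_small_nbhd_difference_le) auto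
  also have "\<dots> = real (card ?P) * exp (- 2 * \<epsilon>\<^sup>2 / real (n - 2))"
    by simp
  also have "\<dots> \<le> real (card ({..<n} \<times> {..<n})) * exp (- 2 * \<epsilon>\<^sup>2 / real (n - 2))"
    by (intro mult_right_mono of_nat_mono card_mono) auto
  also have "real (card ({..<n} \<times> {..<n})) = (real n)\<^sup>2"
    by (simp add: card_cartesian_product power2_eq_square)
  finally show ?thesis
    using prob_disjoint_isomorphic_copies_le[OF p, of n m] by linarith
qed

text \<open>
  Take \<open>m\<close> and the deviation \<open>\<epsilon>\<close> near \<open>np / 8\<close>: the mean \<open>(n - 2) p (1 - p)\<close> is at least \<open>np / 4\<close>, which
  leaves room for both. The constant 96 gives \<open>\<epsilon>\<^sup>2\<close> enough weight to turn the factor \<open>n\<^sup>2\<close> of the first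
  term into \<open>1 / n\<close>, because \<open>2 \<epsilon>\<^sup>2 / n = np\<^sup>2 / 32\<close>; it also makes each factor
  of the second term that belongs to one of the \<open>m\<close> vertices at most \<open>1 / n\<close>.
\<close>

lemma prob_locally_symmetric_le:
  assumes p: "0 \<le> p" "p \<le> 1 / 2" and n: "n \<ge> 4" and np: "real n * p\<^sup>2 \<ge> 96 * ln (real n)"
  shows "measure_pmf.prob (erdos_renyi n p) {G. locally_symmetric G} \<le> 2 / real n"
proof -
  define q where "q = p * (1 - p)"
  define \<epsilon> where "\<epsilon> = real n * p / 8"
  define m where "m = nat \<lfloor>real n * p / 8\<rfloor>"
  define L where "L = ln (real n)"
  have L: "1 \<le> L" and expL: "exp L = real n"
  proof -
    have "exp 1 \<le> real n"
      using exp_le n by linarith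
    then show "1 \<le> L"
      using n by (simp add: L_def ln_ge_iff)
    show "exp L = real n"
      using n by (simp add: L_def)
  qed
  have q: "p / 2 \<le> q" "2 * q \<le> 1"
  proof -
    have "p * (1 / 2) \<le> p * (1 - p)"
      using p by (intro mult_left_mono) auto
    then show "p / 2 \<le> q"
      by (simp add: q_def)
    have "0 \<le> p\<^sup>2 + (1 - p)\<^sup>2"
      by simp
    then show "2 * q \<le> 1"
      by (simp add: q_def power2_eq_square algebra_simps)
  qed
  have m_le: "real m \<le> real n * p / 8" and m_ge: "real n * p / 8 - 1 \<le> real m"
  proof -
    have "0 \<le> real n * p / 8"
      using p by simp
    then show "real m \<le> real n * p / 8" "real n * p / 8 - 1 \<le> real m"
      unfolding m_def by linarith+
  qed
  have "real m \<ge> 1"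
  proof -
    have "real n * p * p \<le> real n * p * (1 / 2)"
      using p by (intro mult_left_mono) auto
    then have "real n * p \<ge> 192 * L"
      using np by (simp add: power2_eq_square L_def mult.assoc)
    then show ?thesis
      using m_ge L by linarith
  qed
  have "real m \<le> real (n - 2) * (p * (1 - p)) - \<epsilon>"
  proof -
    have "real n / 2 * (p / 2) \<le> real (n - 2) * q"
      using n p q by (intro mult_mono) auto
    then show ?thesis
      using m_le by (simp add: \<epsilon>_def q_def)
  qed
  then have "measure_pmf.prob (erdos_renyi n p) {G. locally_symmetric G} \<le>
      (real n)\<^sup>2 * exp (- 2 * \<epsilon>\<^sup>2 / real (n - 2)) + real n ^ (2 * m) * (1 - 2 * q) ^ (m choose 2)"
    unfolding q_def using p n by (intro prob_locally_symmetric_le_sum) (auto simp: \<epsilon>_def)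
  also have "(real n)\<^sup>2 * exp (- 2 * \<epsilon>\<^sup>2 / real (n - 2)) \<le> 1 / real n"
  proof -
    have "3 * L \<le> real n * p\<^sup>2 / 32"
      using np by (simp add: L_def)
    also have "\<dots> = 2 * \<epsilon>\<^sup>2 / real n"
      using n by (simp add: \<epsilon>_def power2_eq_square field_simps)
    also have "\<dots> \<le> 2 * \<epsilon>\<^sup>2 / real (n - 2)"
      using n by (intro divide_left_mono) auto
    finally have "exp (2 * L) * exp (- 2 * \<epsilon>\<^sup>2 / real (n - 2)) \<le> exp (- L)"
      by (simp flip: exp_add)
    then show ?thesis
      by (simp add: exp_minus expL exp_double divide_inverse)
  qed
  also have "real n ^ (2 * m) * (1 - 2 * q) ^ (m choose 2) \<le> 1 / real n"
  proof -
    have choose: "real (m choose 2) = real m * (real m - 1) / 2"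
      by (induction m) (simp_all add: numeral_2_eq_2 field_simps)
    have "p / 2 * (real n * p / 8 - 2) \<le> q * (real m - 1)"
      (is "_ * ?x \<le> _")
    proof -
      have "p / 2 * ?x \<le> p / 2 * (real m - 1)"
        using p m_ge by (intro mult_left_mono) auto
      also have "\<dots> \<le> q * (real m - 1)"
        using q \<open>real m \<ge> 1\<close> by (intro mult_right_mono) auto
      finally show ?thesis .
    qed
    moreover have "p / 2 * (real n * p / 8 - 2) = real n * p\<^sup>2 / 16 - p"
      by (simp add: power2_eq_square algebra_simps)
    ultimately have neg: "2 * L - q * (real m - 1) \<le> - L"
      using np p L by (simp add: L_def)
    \<comment> \<open>Since \<open>1 - x \<le> exp (- x)\<close>, the second term is at most \<open>exp (m (2 L - q (m - 1)))\<close>, and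
        \<open>neg\<close> says that the inner factor is at most \<open>- L\<close>.\<close>
    have "(1 - 2 * q) ^ (m choose 2) \<le> exp (- 2 * q) ^ (m choose 2)"
      using q exp_ge_add_one_self[of "- 2 * q"] by (intro power_mono) auto
    also have "\<dots> = exp (- (q * (real m * (real m - 1))))"
      by (simp add: choose flip: exp_of_nat_mult)
    finally have "real n ^ (2 * m) * (1 - 2 * q) ^ (m choose 2) \<le>
        exp L ^ (2 * m) * exp (- (q * (real m * (real m - 1))))"
      unfolding expL by (intro mult_left_mono) auto
    also have "\<dots> = exp (real m * (2 * L - q * (real m - 1)))"
      by (simp add: algebra_simps flip: exp_of_nat_mult exp_add)
    also have "\<dots> \<le> exp (- L)"
    proof -
      have "real m * (2 * L - q * (real m - 1)) \<le> real m * (- L)"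
        using neg by (intro mult_left_mono) auto
      also have "\<dots> \<le> 1 * (- L)"
        using \<open>real m \<ge> 1\<close> L by (intro mult_right_mono_neg) auto
      finally show ?thesis by simp
    qed
    finally show ?thesis
      by (simp add: exp_minus expL divide_inverse)
  qed
  finally show ?thesis
    by simp
qed

theorem theorem5p1:
  fixes \<delta>1 \<delta>2 :: real and p :: "nat \<Rightarrow> real"
  assumes "\<delta>1 > 0" and "\<delta>2 > 0"
    and "\<And>n. p n \<in> {0..1}"
    and "p \<in> \<omega>(\<lambda>n. real n powr (- 1 / 2 + \<delta>1))"
    and "p \<in> o(\<lambda>n. real n powr (- 3 / 7 - \<delta>2))"
  shows "(\<lambda>n. measure_pmf.prob (erdos_renyi n (p n)) {G. locally_asymmetric G}) \<longlonglongrightarrow> 1"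
proof -
  let ?sym = "\<lambda>n. measure_pmf.prob (erdos_renyi n (p n)) {G. locally_symmetric G}"
  have lower: "\<forall>\<^sub>F n in sequentially. real n powr (- 1 / 2 + \<delta>1) \<le> p n"
    using landau_omega.smallD[OF assms(4), of 1] assms(3) by simp
  have upper: "\<forall>\<^sub>F n in sequentially. p n \<le> 1 / 2"
  proof -
    have "\<forall>\<^sub>F n in sequentially. p n \<le> 1 / 2 * real n powr (- 3 / 7 - \<delta>2)"
      using landau_o.smallD[OF assms(5), of "1 / 2"] assms(3) by simp
    then show ?thesis
      using eventually_ge_at_top[of 1]
    proof eventually_elim
      case (elim n)
      have "real n powr (- 3 / 7 - \<delta>2) \<le> real n powr 0"
        using elim assms(2) by (intro powr_mono) auto
      then show ?case
        using elim by simp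
    qed
  qed
  \<comment> \<open>The lower bound on \<open>p\<close> gives \<open>np\<^sup>2 \<ge> n powr (2 * \<delta>1)\<close>, which must exceed the logarithm.\<close>
  have log_small: "\<forall>\<^sub>F n in sequentially. 96 * ln (real n) \<le> real n powr (2 * \<delta>1)"
  proof -
    have "(\<lambda>n. ln (real n) / real n powr (2 * \<delta>1)) \<longlonglongrightarrow> 0"
      using assms(1) by (intro lim_ln_over_power) simp
    then have "\<forall>\<^sub>F n in sequentially. ln (real n) / real n powr (2 * \<delta>1) < 1 / 96"
      by (rule order_tendstoD) simp
    then show ?thesis
      using eventually_ge_at_top[of 1] by eventually_elim (simp add: field_simps)
  qed
  have "\<forall>\<^sub>F n in sequentially. ?sym n \<le> 2 / real n"
    using lower upper log_small eventually_ge_at_top[of 4]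
  proof eventually_elim
    case (elim n)
    have "real n powr (2 * \<delta>1) = real n powr 1 * (real n powr (- 1 / 2 + \<delta>1) * real n powr (- 1 / 2 + \<delta>1))"
      unfolding powr_add[symmetric] by (simp add: algebra_simps)
    also have "\<dots> \<le> real n * (p n)\<^sup>2"
      using elim assms(3)[of n] by (simp add: power2_eq_square mult_mono)
    finally have "96 * ln (real n) \<le> real n * (p n)\<^sup>2"
      using elim by linarith
    then show ?case
      using elim assms(3)[of n] by (intro prob_locally_symmetric_le) auto
  qed
  then have "?sym \<longlonglongrightarrow> 0"
    by (intro tendsto_sandwich[OF _ _ tendsto_const lim_const_over_n]) auto
  then have "(\<lambda>n. 1 - ?sym n) \<longlonglongrightarrow> 1 - 0"
    by (intro tendsto_intros)
  moreover have "measure_pmf.prob (erdos_renyi n (p n)) {G. locally_asymmetric G} = 1 - ?sym n" for n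
    using measure_pmf.prob_compl[of "{G. locally_symmetric G}" "erdos_renyi n (p n)"]
    by (simp add: locally_asymmetric_def set_diff_eq)
  ultimately show ?thesis
    by simp
qed

end
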